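(* Let $n\geq 4$ be an even integer, let $-\infty<a<n$ and $1<p<+\infty$, and let $u$ be a nonnegative (classical) solution of the critical order Hardy–Hénon equation $$(-\Delta)^{\frac{n}{2}}u(x)=\frac{u^{p}(x)}{|x|^{a}}\quad\text{in }\mathbb{R}^{n},\qquad u(x)\geq 0,\ x\in\mathbb{R}^{n},$$ where $u\in C^{n}(\mathbb{R}^{n})$ if $-\infty<a\leq 0$, and $u\in C^{n}(\mathbb{R}^{n}\setminus\{0\})\cap C^{n-2}(\mathbb{R}^{n})$ if $0<a<n$. Suppose that at least one of the following two assumptions holds: $$-\infty<a\leq 2+2p,\qquad\text{or}\qquad u(x)=o(|x|^{2})\ \text{ as }|x|\to+\infty.$$ Then $u\equiv 0$ in $\mathbb{R}^{n}$.
   Context: Solutions are classical: the equation holds pointwise. When $0<a<n$ the equation is understood pointwise at every $x\neq 0$ (where $u$ is $C^n$ and $|x|^{-a}$ is finite). *)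

theory Defs
  imports "HOL-Analysis.Analysis" "HOL-Library.Landau_Symbols"
begin

definition partial_deriv ::
  "'a::euclidean_space \<Rightarrow> ('a \<Rightarrow> real) \<Rightarrow> 'a \<Rightarrow> real" where
  "partial_deriv b f x = frechet_derivative f (at x) b"

(* The class C^k(S); meant for open S only. A function is C^(k+1) iff it is differentiable
   and each of its first-order partial derivatives is C^k. *)
primrec C_k_on :: "nat \<Rightarrow> ('a::euclidean_space \<Rightarrow> real) \<Rightarrow> 'a set \<Rightarrow> bool" where
  "C_k_on 0 f S \<longleftrightarrow> continuous_on S f"
| "C_k_on (Suc k) f S \<longleftrightarrow>
     f differentiable_on S \<and> (\<forall>b\<in>Basis. C_k_on k (partial_deriv b f) S)"

definition laplacian :: "('a::euclidean_space \<Rightarrow> real) \<Rightarrow> 'a \<Rightarrow> real" where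
  "laplacian f x = (\<Sum>b\<in>Basis. partial_deriv b (partial_deriv b f) x)"

definition neg_laplacian_power ::
  "nat \<Rightarrow> ('a::euclidean_space \<Rightarrow> real) \<Rightarrow> 'a \<Rightarrow> real" where
  "neg_laplacian_power m f = ((\<lambda>g x. - laplacian g x) ^^ m) f"

(* The weight |x|^(-a). For a = 0 it is 1 everywhere, which has to be said separately
   because 0 powr 0 = 0. For a < 0 its value at the origin is 0, as it should be;
   for a > 0 its value at the origin is meaningless and must not be used. *)
definition henon_weight :: "real \<Rightarrow> 'a::euclidean_space \<Rightarrow> real" where
  "henon_weight a x = (if a = 0 then 1 else norm x powr (- a))"

(* u is a nonnegative classical solution of (-Delta)^(n/2) u = u^p / |x|^a, where n is the
   dimension of the space (used for even n). For a > 0 the equation is only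
   required away from the origin. *)
definition hardy_henon_solution ::
  "real \<Rightarrow> real \<Rightarrow> ('a::euclidean_space \<Rightarrow> real) \<Rightarrow> bool" where
  "hardy_henon_solution a p u \<longleftrightarrow>
     (if a \<le> 0 then C_k_on DIM('a) u UNIV
      else C_k_on DIM('a) u (- {0}) \<and> C_k_on (DIM('a) - 2) u UNIV) \<and>
     (\<forall>x. 0 \<le> u x) \<and>
     (\<forall>x. a \<le> 0 \<or> x \<noteq> 0 \<longrightarrow>
        neg_laplacian_power (DIM('a) div 2) u x = henon_weight a x * u x powr p)"

end

theory Submission
  imports Defs "HOL-Computational_Algebra.Polynomial"
begin

text \<open>
  The proof is the nonlinear capacity argument of Mitidieri and Pokhozhaev. Let $n = 2m$ and
  $f = |x|^{-a} u^p$, let $\varphi$ be a radial cutoff that is $1$ on the unit ball, put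
  $\varphi_R(x) = \varphi(x/R)$, and test the equation with $\varphi_R - \varphi_\varepsilon$,
  which is supported away from the origin:
  \[ \int f (\varphi_R - \varphi_\varepsilon)
     = \int u\, (-\Delta)^m \varphi_R - \int u\, (-\Delta)^m \varphi_\varepsilon. \]
  As the order equals the dimension, $(-\Delta)^m \varphi_\varepsilon$ is bounded in $L^1$ and has
  integral $0$, so the last term tends to $0$ with $\varepsilon$ by continuity of $u$ at the origin.
  If $\varphi$ vanishes to high order at the boundary of its support, then
  $|(-\Delta)^m \varphi| \le C \varphi^{1/p}$, and Young's inequality bounds the other term by
  $\frac12 \int f (\varphi_R - \varphi_\varepsilon) + C R^{(a-n)/(p-1)}$. Since $a < n$, letting
  $\varepsilon \to 0$ and $R \to \infty$ gives $\int f = 0$.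
\<close>

subsection \<open>The classes $C^k$\<close>

text \<open>Agreement on an open set makes the two derivative predicates equivalent. As
  \<open>frechet_derivative\<close> is a choice from that predicate, the chosen values coincide even
  where no derivative exists.\<close>

lemma partial_deriv_cong:
  fixes f g :: "'a::euclidean_space \<Rightarrow> real"
  assumes "open S" "x \<in> S" "\<And>y. y \<in> S \<Longrightarrow> f y = g y"
  shows "partial_deriv b f x = partial_deriv b g x"
proof -
  have "(f has_derivative D) (at x) \<longleftrightarrow> (g has_derivative D) (at x)" for D
    using assms has_derivative_transform_within_open[of f D x UNIV S g]
      has_derivative_transform_within_open[of g D x UNIV S f] by auto
  then show ?thesis by (simp add: partial_deriv_def frechet_derivative_def)
qed

lemma C_k_on_cong:
  fixes f g :: "'a::euclidean_space \<Rightarrow> real"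
  assumes "open S" "\<And>y. y \<in> S \<Longrightarrow> f y = g y" "C_k_on k f S"
  shows "C_k_on k g S"
  using assms(2,3)
proof (induction k arbitrary: f g)
  case 0
  then show ?case by (simp cong: continuous_on_cong)
next
  case (Suc k)
  have "g differentiable_on S"
    using Suc.prems by (auto simp: differentiable_on_def intro: differentiable_transform_within[OF _ zero_less_one])
  moreover have "C_k_on k (partial_deriv b g) S" if "b \<in> Basis" for b
    using Suc.IH[of "partial_deriv b f" "partial_deriv b g"] partial_deriv_cong[OF assms(1), of _ f g] Suc.prems that
    by auto
  ultimately show ?case by simp
qed

lemma C_k_on_imp_has_derivative:
  fixes f :: "'a::euclidean_space \<Rightarrow> real"
  assumes "open S" "C_k_on (Suc k) f S" "x \<in> S"
  shows "(f has_derivative frechet_derivative f (at x)) (at x)"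
  using assms by (simp add: differentiable_on_eq_differentiable_at frechet_derivative_works[symmetric])

lemma C_k_on_Suc_imp:
  fixes f :: "'a::euclidean_space \<Rightarrow> real"
  shows "C_k_on (Suc k) f S \<Longrightarrow> C_k_on k f S"
proof (induction k arbitrary: f)
  case 0
  then show ?case by (simp add: differentiable_imp_continuous_on)
next
  case (Suc k)
  then show ?case by (metis C_k_on.simps(2))
qed

lemma C_k_on_mono:
  fixes f :: "'a::euclidean_space \<Rightarrow> real"
  assumes "C_k_on k f S" "j \<le> k"
  shows "C_k_on j f S"
  using assms(2,1) by (induction rule: dec_induct) (auto intro: C_k_on_Suc_imp simp del: C_k_on.simps)

lemma C_k_on_subset:
  fixes f :: "'a::euclidean_space \<Rightarrow> real"
  shows "C_k_on k f S \<Longrightarrow> T \<subseteq> S \<Longrightarrow> C_k_on k f T"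
  by (induction k arbitrary: f) (auto intro: continuous_on_subset differentiable_on_subset)

lemma C_k_on_const [simp]: "C_k_on k (\<lambda>x::'a::euclidean_space. c) S"
proof (induction k arbitrary: c)
  case (Suc k)
  have "partial_deriv b (\<lambda>x::'a. c) = (\<lambda>x. 0)" for b
    by (simp add: partial_deriv_def fun_eq_iff)
  with Suc show ?case by simp
qed simp

lemma C_k_on_add:
  fixes f g :: "'a::euclidean_space \<Rightarrow> real"
  assumes "open S" "C_k_on k f S" "C_k_on k g S"
  shows "C_k_on k (\<lambda>x. f x + g x) S"
  using assms(2,3)
proof (induction k arbitrary: f g)
  case 0
  then show ?case by (simp add: continuous_on_add)
next
  case (Suc k)
  have eq: "partial_deriv b (\<lambda>x. f x + g x) x = partial_deriv b f x + partial_deriv b g x"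
    if "x \<in> S" for x b
  proof -
    have "((\<lambda>x. f x + g x) has_derivative
        (\<lambda>h. frechet_derivative f (at x) h + frechet_derivative g (at x) h)) (at x)"
      by (intro has_derivative_add C_k_on_imp_has_derivative[OF assms(1) _ that]) (use Suc.prems in auto)
    from frechet_derivative_at[OF this] show ?thesis by (simp add: partial_deriv_def fun_eq_iff)
  qed
  have "C_k_on k (partial_deriv b (\<lambda>x. f x + g x)) S" if "b \<in> Basis" for b
    by (rule C_k_on_cong[OF assms(1) _ Suc.IH[of "partial_deriv b f" "partial_deriv b g"]])
      (use eq Suc.prems that in auto)
  with Suc.prems show ?case by (simp add: differentiable_on_add)
qed

lemma C_k_on_minus:
  fixes f :: "'a::euclidean_space \<Rightarrow> real"
  assumes "open S" "C_k_on k f S"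
  shows "C_k_on k (\<lambda>x. - f x) S"
  using assms(2)
proof (induction k arbitrary: f)
  case 0
  then show ?case by (simp add: continuous_on_minus)
next
  case (Suc k)
  have eq: "partial_deriv b (\<lambda>x. - f x) x = - partial_deriv b f x" if "x \<in> S" for x b
  proof -
    have "((\<lambda>x. - f x) has_derivative (\<lambda>h. - frechet_derivative f (at x) h)) (at x)"
      by (intro has_derivative_minus C_k_on_imp_has_derivative[OF assms(1) _ that]) (use Suc.prems in auto)
    from frechet_derivative_at[OF this] show ?thesis by (simp add: partial_deriv_def fun_eq_iff)
  qed
  have "C_k_on k (partial_deriv b (\<lambda>x. - f x)) S" if "b \<in> Basis" for b
    by (rule C_k_on_cong[OF assms(1) _ Suc.IH[of "partial_deriv b f"]])
      (use eq Suc.prems that in auto)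
  with Suc.prems show ?case by (simp add: differentiable_on_minus)
qed

lemma C_k_on_sum:
  fixes f :: "'i \<Rightarrow> 'a::euclidean_space \<Rightarrow> real"
  assumes "open S" "finite I" "\<And>i. i \<in> I \<Longrightarrow> C_k_on k (f i) S"
  shows "C_k_on k (\<lambda>x. \<Sum>i\<in>I. f i x) S"
  using assms(2,3) by (induction I) (auto intro: C_k_on_add[OF assms(1)])

lemma C_k_on_laplacian:
  fixes f :: "'a::euclidean_space \<Rightarrow> real"
  assumes "open S" "C_k_on (Suc (Suc k)) f S"
  shows "C_k_on k (laplacian f) S"
  unfolding laplacian_def[abs_def]
  by (rule C_k_on_sum[OF assms(1)]) (use assms in auto)

lemma C_k_on_neg_laplacian_power:
  fixes f :: "'a::euclidean_space \<Rightarrow> real"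
  assumes "open S" "C_k_on (2 * i + k) f S"
  shows "C_k_on k (neg_laplacian_power i f) S"
  using assms(2)
proof (induction i arbitrary: k)
  case 0
  then show ?case by (simp add: neg_laplacian_power_def)
next
  case (Suc i)
  from Suc.IH[of "Suc (Suc k)"] Suc.prems show ?case
    by (auto simp: neg_laplacian_power_def intro!: C_k_on_minus C_k_on_laplacian assms(1))
qed

subsection \<open>Integration by parts against radial functions\<close>

text \<open>By translation invariance, all difference quotients of \<open>F\<close> have integral 0.\<close>
lemma integral_directional_derivative_eq_0:
  fixes F :: "'a::euclidean_space \<Rightarrow> real"
  assumes der: "\<And>x. (F has_derivative F' x) (at x)"
    and cont: "continuous_on UNIV (\<lambda>x. F' x b)"
    and supp: "\<And>x. x \<notin> cball 0 r \<Longrightarrow> F x = 0"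
  shows "integral\<^sup>L lborel (\<lambda>x. F' x b) = 0"
proof -
  define t where "t k = inverse (real (Suc k))" for k
  define D where "D k x = (F (x + t k *\<^sub>R b) - F x) / t k" for k x
  let ?G = "\<lambda>x. F' x b"
  let ?K = "cball 0 (r + norm b) :: 'a set"
  have t: "0 < t k" "t k \<le> 1" for k by (auto simp: t_def field_simps)
  have t_lim: "t \<longlonglongrightarrow> 0" unfolding t_def by (rule LIMSEQ_inverse_real_of_nat)
  have contF: "continuous_on UNIV F"
    using der by (metis continuous_at_imp_continuous_on has_derivative_continuous)
  have F_int: "integrable lborel F"
  proof -
    have "integrable lborel (\<lambda>x. indicator (cball 0 r) x *\<^sub>R F x)"
      by (intro borel_integrable_compact compact_cball continuous_on_subset[OF contF]) auto
    also have "(\<lambda>x. indicator (cball 0 r) x *\<^sub>R F x) = F"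
      using supp by (auto simp: indicator_def fun_eq_iff)
    finally show ?thesis .
  qed
  have shift: "integrable lborel (\<lambda>x. F (x + c))"
    "integral\<^sup>L lborel (\<lambda>x. F (x + c)) = integral\<^sup>L lborel F" for c
    using F_int
      integrable_distr_eq[of "(+) c" lborel borel F]
      integral_distr[of "(+) c" lborel borel F] lborel_distr_plus[of c]
    by (simp_all add: add.commute borel_measurable_integrable)
  have D0: "integral\<^sup>L lborel (D k) = 0" for k
    unfolding D_def using shift[of "t k *\<^sub>R b"] F_int by simp
  have path: "((\<lambda>s. F (x + s *\<^sub>R b)) has_real_derivative ?G (x + s *\<^sub>R b)) (at s)" for x s
  proof -
    have "((\<lambda>s. F (x + s *\<^sub>R b)) has_derivative (\<lambda>h. F' (x + s *\<^sub>R b) (h *\<^sub>R b))) (at s)"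
      by (rule has_derivative_compose[OF _ der]) (auto intro!: derivative_eq_intros)
    moreover have "F' y (h *\<^sub>R b) = ?G y * h" for y h
      using linear_cmul[OF has_derivative_linear[OF der]] by (simp add: mult.commute)
    ultimately show ?thesis by (simp add: has_field_derivative_def)
  qed
  obtain B where B: "\<bar>?G x\<bar> \<le> B" if "x \<in> cball 0 (r + 2 * norm b)" for x
  proof -
    have "compact (?G ` cball 0 (r + 2 * norm b))"
      by (intro compact_continuous_image continuous_on_subset[OF cont]) auto
    then obtain B where "\<forall>y\<in>?G ` cball 0 (r + 2 * norm b). norm y \<le> B"
      by (meson compact_imp_bounded bounded_iff)
    then show ?thesis by (intro that[of B]) simp
  qed
  \<comment> \<open>Since \<open>t k \<le> 1\<close>, a point outside \<open>?K\<close> and its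
    translate both lie off the support. Inside \<open>?K\<close> the mean value theorem applies, and
    its intermediate point stays in the larger ball on which \<open>B\<close> bounds the
    derivative.\<close>
  have dom: "norm (D k x) \<le> B * indicator ?K x" for k x
  proof (cases "x \<in> ?K")
    case True
    obtain s where s: "0 < s" "s < t k" "F (x + t k *\<^sub>R b) - F (x + 0 *\<^sub>R b) = (t k - 0) * ?G (x + s *\<^sub>R b)"
      using MVT2[OF t(1)[of k], of "\<lambda>s. F (x + s *\<^sub>R b)" "\<lambda>s. ?G (x + s *\<^sub>R b)"] path by blast
    have "s * norm b \<le> norm b" using s t(2)[of k] by (simp add: mult_left_le_one_le)
    then have "norm (x + s *\<^sub>R b) \<le> r + 2 * norm b"
      using True s norm_triangle_ineq[of x "s *\<^sub>R b"] by simp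
    with s t(1)[of k] B[of "x + s *\<^sub>R b"] True show ?thesis by (simp add: D_def)
  next
    case False
    have "t k * norm b \<le> norm b" using t[of k] by (simp add: mult_left_le_one_le)
    then have "norm (x + t k *\<^sub>R b) > r" "norm x > r"
      using False t(1)[of k] norm_triangle_ineq4[of "x + t k *\<^sub>R b" "t k *\<^sub>R b"] norm_ge_zero[of b]
      by (auto simp del: norm_ge_zero)
    with False show ?thesis by (simp add: D_def supp)
  qed
  have lim: "(\<lambda>k. D k x) \<longlonglongrightarrow> ?G x" for x
  proof -
    have "((\<lambda>h. (F (x + h *\<^sub>R b) - F x) / h) \<longlongrightarrow> ?G x) (at 0)"
      using path[of x 0] by (simp add: DERIV_def)
    moreover have "filterlim t (at 0) sequentially"
      using t_lim t by (auto simp: filterlim_at intro!: always_eventually simp: less_imp_neq[symmetric])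
    ultimately show ?thesis unfolding D_def by (rule filterlim_compose)
  qed
  have "(\<lambda>k. integral\<^sup>L lborel (D k)) \<longlonglongrightarrow> integral\<^sup>L lborel ?G"
  proof (rule integral_dominated_convergence[where w = "\<lambda>x. B * indicator ?K x"])
    show "?G \<in> borel_measurable lborel" using cont by (simp add: borel_measurable_continuous_onI)
    show "D k \<in> borel_measurable lborel" for k
      unfolding D_def using contF t(1)[of k]
      by (auto intro!: borel_measurable_continuous_onI continuous_intros continuous_on_compose2[OF contF])
    show "integrable lborel (\<lambda>x. B * indicator ?K x)"
      by (intro integrable_mult_right integrable_real_indicator) (use emeasure_lborel_cball_finite[of "0::'a" "r + norm b"] in \<open>simp_all add: infinity_ennreal_def\<close>)
  qed (use dom lim in auto)
  then show ?thesis by (simp add: D0 LIMSEQ_const_iff)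
qed

lemma continuous_on_UNIV_if_vanishes_near_0:
  fixes G :: "'a::real_normed_vector \<Rightarrow> 'b::real_normed_vector"
  assumes "continuous_on (- {0}) G" "0 < r" "\<And>x. norm x < r \<Longrightarrow> G x = 0"
  shows "continuous_on UNIV G"
proof -
  have "continuous_on (ball 0 r) G"
    using assms(3) by (subst continuous_on_cong[where g = "\<lambda>_. 0"]) auto
  then have "continuous_on (- {0} \<union> ball 0 r) G"
    using assms(1) by (intro continuous_on_open_Un) auto
  moreover have "- {0} \<union> ball 0 r = (UNIV :: 'a set)" using assms(2) by auto
  ultimately show ?thesis by simp
qed

text \<open>The product lives on the annulus \<alpha> \<le> |x|^2 \<le> \<beta>, a compact set that
  avoids the origin because \<open>0 < \<alpha>\<close>. Thus \<open>g\<close> may be singular at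
  the origin.\<close>

lemma integrable_radial_cutoff:
  fixes g :: "'a::euclidean_space \<Rightarrow> real"
  assumes g: "continuous_on (- {0}) g" and \<eta>: "continuous_on UNIV \<eta>"
    and supp: "\<And>s. s \<notin> {\<alpha>..\<beta>} \<Longrightarrow> \<eta> s = 0" and "0 < \<alpha>"
  shows "integrable lborel (\<lambda>x. g x * \<eta> ((norm x)\<^sup>2))"
proof -
  define K where "K = (\<lambda>x::'a. (norm x)\<^sup>2) -` {\<alpha>..\<beta>}"
  have "closed K" unfolding K_def by (intro closed_vimage continuous_intros closed_atLeastAtMost)
  moreover have "bounded K"
    unfolding bounded_iff K_def by (intro exI[of _ "sqrt \<beta>"]) (auto intro: real_le_rsqrt)
  ultimately have "compact K" by (simp add: compact_eq_bounded_closed)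
  moreover have "continuous_on K (\<lambda>x. g x * \<eta> ((norm x)\<^sup>2))"
  proof -
    have "0 \<notin> K" using \<open>0 < \<alpha>\<close> by (simp add: K_def)
    then show ?thesis
      by (intro continuous_intros continuous_on_subset[OF g] continuous_on_compose2[OF \<eta>]) auto
  qed
  ultimately have "integrable lborel (\<lambda>x. indicator K x *\<^sub>R (g x * \<eta> ((norm x)\<^sup>2)))"
    by (rule borel_integrable_compact)
  also have "(\<lambda>x. indicator K x *\<^sub>R (g x * \<eta> ((norm x)\<^sup>2))) = (\<lambda>x. g x * \<eta> ((norm x)\<^sup>2))"
    using supp by (auto simp: K_def indicator_def fun_eq_iff)
  finally show ?thesis .
qed

lemma deriv_eq_0_outside:
  fixes \<eta> :: "real \<Rightarrow> real"
  assumes "\<And>s. (\<eta> has_real_derivative \<eta>' s) (at s)"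
    and "\<And>s. s \<notin> {\<alpha>..\<beta>} \<Longrightarrow> \<eta> s = 0" and "s \<notin> {\<alpha>..\<beta>}"
  shows "\<eta>' s = 0"
proof -
  have "((\<lambda>_. 0) has_real_derivative \<eta>' s) (at s)"
    by (rule has_field_derivative_transform_within_open[OF assms(1), of "- {\<alpha>..\<beta>}"]) (use assms in auto)
  then show ?thesis using DERIV_const DERIV_unique by blast
qed

text \<open>Green's second identity for \<open>v\<close> and the radial function \<eta>(|x|^2),
  whose Laplacian is the bracket on the right. The vector field with components \<open>F b\<close>
  is compactly supported away from the origin and its divergence is the difference of the two
  integrands, so that difference has integral 0.\<close>

lemma integral_laplacian_radial:
  fixes v :: "'a::euclidean_space \<Rightarrow> real" and \<eta> \<eta>1 \<eta>2 :: "real \<Rightarrow> real"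
  assumes v: "C_k_on (Suc (Suc 0)) v (- {0})"
    and \<eta>: "\<And>s. (\<eta> has_real_derivative \<eta>1 s) (at s)"
    and \<eta>1: "\<And>s. (\<eta>1 has_real_derivative \<eta>2 s) (at s)"
    and \<eta>2: "continuous_on UNIV \<eta>2"
    and supp: "\<And>s. s \<notin> {\<alpha>..\<beta>} \<Longrightarrow> \<eta> s = 0" and "0 < \<alpha>"
  shows "integral\<^sup>L lborel (\<lambda>x. laplacian v x * \<eta> ((norm x)\<^sup>2)) =
    integral\<^sup>L lborel (\<lambda>x. v x * (4 * (norm x)\<^sup>2 * \<eta>2 ((norm x)\<^sup>2) + 2 * DIM('a) * \<eta>1 ((norm x)\<^sup>2)))"
proof -
  let ?N = "\<lambda>x::'a. (norm x)\<^sup>2"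
  have supp1: "\<eta>1 s = 0" if "s \<notin> {\<alpha>..\<beta>}" for s
    by (rule deriv_eq_0_outside[OF \<eta> supp that])
  have supp2: "\<eta>2 s = 0" if "s \<notin> {\<alpha>..\<beta>}" for s
    by (rule deriv_eq_0_outside[OF \<eta>1 supp1 that])
  have c: "continuous_on UNIV \<eta>" "continuous_on UNIV \<eta>1"
    using \<eta> \<eta>1 by (auto intro!: continuous_at_imp_continuous_on DERIV_isCont)
  have vcont: "continuous_on (- {0}) v"
    using C_k_on_mono[OF v, of 0] by simp
  have dv: "C_k_on (Suc 0) (partial_deriv b v) (- {0})" if "b \<in> Basis" for b
    using v that by simp
  have ddvc: "continuous_on (- {0}) (partial_deriv b (partial_deriv b v))" if "b \<in> Basis" for b
    using dv[OF that] that by simp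
  define F where "F b x = partial_deriv b v x * \<eta> (?N x) - v x * (2 * (x \<bullet> b) * \<eta>1 (?N x))" for b x
  \<comment> \<open>The full derivative of \<open>F b\<close> by the product rule. The origin is
    split off because \<open>v\<close> is smooth only away from it; there \<open>F b\<close>
    vanishes on a whole ball.\<close>
  define F' where "F' b x = (if x = 0 then (\<lambda>_. 0) else (\<lambda>h.
      frechet_derivative (partial_deriv b v) (at x) h * \<eta> (?N x)
      + partial_deriv b v x * (\<eta>1 (?N x) * (2 * (x \<bullet> h)))
      - (frechet_derivative v (at x) h * (2 * (x \<bullet> b) * \<eta>1 (?N x))
         + v x * (2 * (h \<bullet> b) * \<eta>1 (?N x) + 2 * (x \<bullet> b) * (\<eta>2 (?N x) * (2 * (x \<bullet> h)))))))" for b x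
  \<comment> \<open>This is the derivative of \<open>F b\<close> in direction \<open>b\<close>: the
    two terms containing the first derivative of \<open>v\<close> cancel.\<close>
  define G where "G b x = partial_deriv b (partial_deriv b v) x * \<eta> (?N x)
      - (2 * v x) * \<eta>1 (?N x) - (v x * (4 * (x \<bullet> b)\<^sup>2)) * \<eta>2 (?N x)" for b x
  have near0: "\<eta> (?N x) = 0 \<and> \<eta>1 (?N x) = 0 \<and> \<eta>2 (?N x) = 0" if "norm x < sqrt \<alpha>" for x :: 'a
  proof -
    have "?N x < (sqrt \<alpha>)\<^sup>2" using that by (intro power_strict_mono) auto
    then have "?N x < \<alpha>" using \<open>0 < \<alpha>\<close> by simp
    then show ?thesis using supp supp1 supp2 by simp
  qed
  have norm_deriv: "(?N has_derivative (\<lambda>h. 2 * (x \<bullet> h))) (at x)" for x :: 'a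
    unfolding power2_norm_eq_inner by (auto intro!: derivative_eq_intros simp: inner_commute)
  have rad: "((\<lambda>x. q (?N x)) has_derivative (\<lambda>h. q' (?N x) * (2 * (x \<bullet> h)))) (at x)"
    if "\<And>s. (q has_real_derivative q' s) (at s)" for q q' :: "real \<Rightarrow> real" and x :: 'a
    using has_derivative_compose[OF norm_deriv[of x], of q "(*) (q' (?N x))"] that
    by (simp add: has_field_derivative_def)
  have F_der: "(F b has_derivative F' b x) (at x)" if b: "b \<in> Basis" for b x
  proof (cases "x = 0")
    case True
    have "((\<lambda>_. 0) has_derivative (\<lambda>_. 0)) (at x)" by simp
    then have "(F b has_derivative (\<lambda>_. 0)) (at x)"
      by (rule has_derivative_transform_within_open[of _ _ _ _ "ball 0 (sqrt \<alpha>)"])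
        (use True near0 \<open>0 < \<alpha>\<close> in \<open>auto simp: F_def\<close>)
    then show ?thesis using True by (simp add: F'_def)
  next
    case False
    have "(v has_derivative frechet_derivative v (at x)) (at x)"
      "(partial_deriv b v has_derivative frechet_derivative (partial_deriv b v) (at x)) (at x)"
      using False C_k_on_imp_has_derivative[OF _ v, of x] C_k_on_imp_has_derivative[OF _ dv[OF b], of x]
      by auto
    note * = this rad[OF \<eta>, of x] rad[OF \<eta>1, of x]
    have **: "((\<lambda>x. 2 * (x \<bullet> b)) has_derivative (\<lambda>h. 2 * (h \<bullet> b))) (at x)"
      by (auto intro!: derivative_eq_intros)
    show ?thesis
      unfolding F_def[abs_def]
      by (rule has_derivative_eq_rhs[OF has_derivative_diff[OF has_derivative_mult[OF *(2,3)]
            has_derivative_mult[OF *(1) has_derivative_mult[OF ** *(4)]]]])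
        (use False in \<open>auto simp: F'_def fun_eq_iff algebra_simps\<close>)
  qed
  have F'_G: "F' b x b = G b x" if b: "b \<in> Basis" for b x
  proof (cases "x = 0")
    case True
    then show ?thesis using near0[of 0] \<open>0 < \<alpha>\<close> by (simp add: F'_def G_def)
  next
    case False
    then show ?thesis using b
      by (simp add: F'_def G_def partial_deriv_def algebra_simps power2_eq_square)
  qed
  have G0: "integral\<^sup>L lborel (G b) = 0" if b: "b \<in> Basis" for b
  proof -
    have "continuous_on (- {0}) (G b)"
      unfolding G_def
      by (intro continuous_intros vcont ddvc[OF b] continuous_on_compose2[OF c(1)]
        continuous_on_compose2[OF c(2)] continuous_on_compose2[OF \<eta>2]) auto
    then have "continuous_on UNIV (G b)"
      by (rule continuous_on_UNIV_if_vanishes_near_0[of _ "sqrt \<alpha>"])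
        (use near0 \<open>0 < \<alpha>\<close> in \<open>auto simp: G_def\<close>)
    moreover have "F b x = 0" if "x \<notin> cball 0 (sqrt \<beta>)" for x
    proof -
      have "?N x \<notin> {\<alpha>..\<beta>}" using that by (auto simp: real_le_rsqrt)
      then show ?thesis using supp supp1 by (simp add: F_def)
    qed
    ultimately show ?thesis
      using integral_directional_derivative_eq_0[of "F b" "F' b" b "sqrt \<beta>"] F_der[OF b] F'_G[OF b]
      by simp
  qed
  have G_int: "integrable lborel (G b)" if b: "b \<in> Basis" for b
    unfolding G_def
    by (intro Bochner_Integration.integrable_diff integrable_radial_cutoff[where \<alpha> = \<alpha> and \<beta> = \<beta>]
      continuous_intros vcont ddvc[OF b] c \<eta>2 supp supp1 supp2 \<open>0 < \<alpha>\<close>) auto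
  let ?L = "\<lambda>x. laplacian v x * \<eta> (?N x)"
  let ?R = "\<lambda>x. v x * (4 * ?N x * \<eta>2 (?N x) + 2 * DIM('a) * \<eta>1 (?N x))"
  have sumG: "(\<Sum>b\<in>Basis. G b x) = ?L x - ?R x" for x
  proof -
    have "?N x = (\<Sum>b\<in>Basis. (x \<bullet> b)\<^sup>2)"
      unfolding power2_norm_eq_inner by (subst euclidean_inner) (simp add: power2_eq_square)
    moreover have "(\<Sum>b\<in>Basis. G b x) = laplacian v x * \<eta> (?N x) - DIM('a) * (2 * v x * \<eta>1 (?N x))
        - v x * (4 * (\<Sum>b\<in>Basis. (x \<bullet> b)\<^sup>2)) * \<eta>2 (?N x)"
      by (simp add: G_def laplacian_def sum_subtractf sum_distrib_left sum_distrib_right)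
    ultimately show ?thesis by (simp add: algebra_simps)
  qed
  have "integrable lborel ?L"
    by (rule integrable_radial_cutoff[where \<alpha> = \<alpha> and \<beta> = \<beta>])
      (use c supp \<open>0 < \<alpha>\<close> ddvc in \<open>auto simp: laplacian_def[abs_def] intro!: continuous_intros\<close>)
  moreover have "integrable lborel ?R"
  proof -
    have "integrable lborel (\<lambda>x. (v x * (4 * ?N x)) * \<eta>2 (?N x) + (v x * (2 * DIM('a))) * \<eta>1 (?N x))"
      by (intro Bochner_Integration.integrable_add integrable_radial_cutoff[where \<alpha> = \<alpha> and \<beta> = \<beta>]
        continuous_intros vcont c \<eta>2 supp1 supp2 \<open>0 < \<alpha>\<close>) auto
    then show ?thesis by (simp add: algebra_simps)
  qed
  ultimately have "integral\<^sup>L lborel ?L - integral\<^sup>L lborel ?R = integral\<^sup>L lborel (\<lambda>x. \<Sum>b\<in>Basis. G b x)"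
    by (simp add: sumG)
  also have "\<dots> = 0" using G_int G0 by (subst Bochner_Integration.integral_sum) auto
  finally show ?thesis by simp
qed

lemma laplacian_const: "laplacian (\<lambda>x::'a::euclidean_space. c) = (\<lambda>x. 0)"
proof -
  have "partial_deriv b (\<lambda>x::'a. k) = (\<lambda>x. 0)" for b k
    by (simp add: partial_deriv_def fun_eq_iff)
  then show ?thesis by (simp add: laplacian_def[abs_def])
qed

text \<open>The family \<psi> lists the profiles of the successive powers of the negative Laplacian
  of the test function, as \<open>step\<close> records. Green's identity moves one Laplacian at a
  time: with \<open>i\<close> of them on \<open>u\<close> and \<open>m - i\<close> on the test
  function, the integral is always the same. For \<open>i < m\<close> the function
  \<open>neg_laplacian_power i u\<close> still has the two derivatives that the next move
  needs.\<close>

lemma integral_neg_laplacian_power_radial: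
  fixes u :: "'a::euclidean_space \<Rightarrow> real" and \<psi> \<psi>' \<psi>'' :: "nat \<Rightarrow> real \<Rightarrow> real"
  assumes u: "C_k_on (2 * m) u (- {0})"
    and \<psi>: "\<And>i s. i < m \<Longrightarrow> (\<psi> i has_real_derivative \<psi>' i s) (at s)"
    and \<psi>': "\<And>i s. i < m \<Longrightarrow> (\<psi>' i has_real_derivative \<psi>'' i s) (at s)"
    and \<psi>'': "\<And>i. continuous_on UNIV (\<psi>'' i)"
    and supp: "\<And>i s. i < m \<Longrightarrow> s \<notin> {\<alpha>..\<beta>} \<Longrightarrow> \<psi> i s = 0" and "0 < \<alpha>"
    and step: "\<And>i s. i < m \<Longrightarrow> \<psi> (Suc i) s = - (4 * s * \<psi>'' i s + 2 * DIM('a) * \<psi>' i s)"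
  shows "integral\<^sup>L lborel (\<lambda>x. neg_laplacian_power m u x * \<psi> 0 ((norm x)\<^sup>2)) =
    integral\<^sup>L lborel (\<lambda>x. u x * \<psi> m ((norm x)\<^sup>2))"
proof -
  have "integral\<^sup>L lborel (\<lambda>x. neg_laplacian_power i u x * \<psi> (m - i) ((norm x)\<^sup>2)) =
      integral\<^sup>L lborel (\<lambda>x. u x * \<psi> m ((norm x)\<^sup>2))" if "i \<le> m" for i
    using that
  proof (induction i)
    case 0
    then show ?case by (simp add: neg_laplacian_power_def)
  next
    case (Suc i)
    let ?v = "neg_laplacian_power i u"
    define j where "j = m - Suc i"
    have j: "j < m" "m - i = Suc j" using Suc.prems by (auto simp: j_def)
    have v: "C_k_on (Suc (Suc 0)) ?v (- {0})"
      by (rule C_k_on_neg_laplacian_power[OF _ C_k_on_mono[OF u]]) (use Suc.prems in auto)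
    have "integral\<^sup>L lborel (\<lambda>x. neg_laplacian_power (Suc i) u x * \<psi> j ((norm x)\<^sup>2))
        = - integral\<^sup>L lborel (\<lambda>x. laplacian ?v x * \<psi> j ((norm x)\<^sup>2))"
      by (simp add: neg_laplacian_power_def)
    also have "\<dots> = - integral\<^sup>L lborel (\<lambda>x. ?v x *
        (4 * (norm x)\<^sup>2 * \<psi>'' j ((norm x)\<^sup>2) + 2 * DIM('a) * \<psi>' j ((norm x)\<^sup>2)))"
      by (subst integral_laplacian_radial[OF v \<psi>[OF j(1)] \<psi>'[OF j(1)] \<psi>'' supp[OF j(1)] \<open>0 < \<alpha>\<close>]) auto
    also have "\<dots> = integral\<^sup>L lborel (\<lambda>x. ?v x * \<psi> (m - i) ((norm x)\<^sup>2))"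
      unfolding j(2) step[OF j(1)] by (simp only: mult_minus_right Bochner_Integration.integral_minus)
    also have "\<dots> = integral\<^sup>L lborel (\<lambda>x. u x * \<psi> m ((norm x)\<^sup>2))"
      using Suc by simp
    finally show ?case by (simp add: j_def)
  qed
  from this[of m] show ?thesis by simp
qed

subsection \<open>A piecewise polynomial cutoff\<close>

text \<open>The function \<open>x \<mapsto> q (|x|\<^sup>2)\<close> on a \<open>d\<close>-dimensional space has the
  Laplacian \<open>x \<mapsto> 4 s q'' s + 2 d q' s\<close> with \<open>s = |x|\<^sup>2\<close>.\<close>
definition radial_neg_laplacian :: "real \<Rightarrow> real poly \<Rightarrow> real poly" where
  "radial_neg_laplacian d q = - (smult 4 (pCons 0 (pderiv (pderiv q))) + smult (2 * d) (pderiv q))"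

text \<open>Composing a polynomial with this retraction onto [1, 2] freezes it at its end values, so
  cutoff profiles can be handled by polynomial algebra.\<close>

definition clamp12 :: "real \<Rightarrow> real" where
  "clamp12 s = max 1 (min 2 s)"

lemma clamp12_bounds: "1 \<le> clamp12 s" "clamp12 s \<le> 2"
  by (auto simp: clamp12_def)

lemma clamp12_lipschitz: "\<bar>clamp12 s - clamp12 t\<bar> \<le> \<bar>s - t\<bar>"
  by (auto simp: clamp12_def max_def min_def abs_if)

lemma continuous_on_clamp12 [continuous_intros]:
  "continuous_on A f \<Longrightarrow> continuous_on A (\<lambda>x. clamp12 (f x))"
  unfolding clamp12_def by (intro continuous_intros)

text \<open>Order of vanishing at \<open>c\<close> is expressed as divisibility by a power of X - c;
  by the product rule one differentiation costs at most one order.\<close>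

lemma linear_power_dvd_pderiv:
  fixes q :: "real poly"
  assumes "[:- c, 1:] ^ Suc k dvd q"
  shows "[:- c, 1:] ^ k dvd pderiv q"
proof -
  obtain r where q: "q = [:- c, 1:] ^ Suc k * r" using assms by (elim dvdE)
  have "[:- c, 1:] ^ k dvd [:- c, 1:] ^ Suc k" by (intro le_imp_power_dvd) simp
  then show ?thesis
    unfolding q pderiv_mult pderiv_power_Suc
    by (intro dvd_add[OF dvd_mult2 dvd_mult[OF dvd_mult2[OF dvd_smult[OF dvd_refl]]]])
qed

text \<open>The operator has no zeroth-order term, so only the derivative of \<open>q\<close> has to
  vanish at \<open>c\<close>. This matters at \<open>c = 1\<close>, where the initial cutoff
  polynomial has value 1.\<close>

lemma linear_power_dvd_radial:
  assumes "[:- c, 1:] ^ Suc k dvd pderiv q"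
  shows "[:- c, 1:] ^ k dvd radial_neg_laplacian d q"
proof -
  have "[:- c, 1:] ^ k dvd pderiv (pderiv q)"
    by (rule linear_power_dvd_pderiv[OF assms])
  then have "[:- c, 1:] ^ k dvd [:0, 1:] * pderiv (pderiv q)" by (rule dvd_mult)
  moreover have "[:- c, 1:] ^ k dvd pderiv q"
    using assms by (rule power_le_dvd) simp
  ultimately show ?thesis
    unfolding radial_neg_laplacian_def by (intro dvd_minus_iff[THEN iffD2] dvd_add dvd_smult) simp_all
qed

lemma poly_eq_0_if_linear_power_dvd:
  fixes q :: "real poly"
  assumes "[:- c, 1:] ^ k dvd q" "0 < k"
  shows "poly q c = 0"
  using assms by (metis dvd_trans dvd_power poly_eq_0_iff_dvd)

text \<open>Between 1 and 2 the clamp is locally the identity. Elsewhere its value is 1 or 2, where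
  \<open>q\<close> has derivative 0; since the clamp is 1-Lipschitz, the first-order error estimate
  of \<open>q\<close> at that value carries over to the composition.\<close>

lemma DERIV_poly_clamp12:
  assumes "poly (pderiv q) 1 = 0" "poly (pderiv q) 2 = 0"
  shows "((\<lambda>s. poly q (clamp12 s)) has_real_derivative poly (pderiv q) (clamp12 s)) (at s)"
proof (cases "1 < s \<and> s < 2")
  case True
  have "((\<lambda>s. poly q (clamp12 s)) has_real_derivative poly (pderiv q) s) (at s)"
    by (rule has_field_derivative_transform_within_open[OF poly_DERIV, of "{1<..<2}"])
      (use True in \<open>auto simp: clamp12_def\<close>)
  then show ?thesis using True by (simp add: clamp12_def)
next
  case False
  then have "clamp12 s = 1 \<or> clamp12 s = 2" by (auto simp: clamp12_def)
  then have 0: "poly (pderiv q) (clamp12 s) = 0" using assms by auto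
  show ?thesis
    unfolding 0 has_field_derivative_def has_derivative_at_alt
  proof (intro conjI allI impI)
    fix e :: real assume "0 < e"
    have "(poly q has_derivative (*) 0) (at (clamp12 s))"
      using poly_DERIV[of q "clamp12 s"] by (simp only: 0 has_field_derivative_def)
    then obtain \<delta> where \<delta>: "0 < \<delta>" "\<And>y. \<bar>y - clamp12 s\<bar> < \<delta> \<Longrightarrow>
        \<bar>poly q y - poly q (clamp12 s)\<bar> \<le> e * \<bar>y - clamp12 s\<bar>"
      using \<open>0 < e\<close> unfolding has_derivative_at_alt by auto
    have "\<bar>poly q (clamp12 y) - poly q (clamp12 s)\<bar> \<le> e * \<bar>y - s\<bar>" if "\<bar>y - s\<bar> < \<delta>" for y
      using \<delta>(2)[of "clamp12 y"] clamp12_lipschitz[of y s] that \<open>0 < e\<close>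
      by (meson le_less_trans mult_left_mono order.trans less_imp_le)
    then show "\<exists>\<delta>>0. \<forall>y. norm (y - s) < \<delta> \<longrightarrow>
        norm (poly q (clamp12 y) - poly q (clamp12 s) - 0 * (y - s)) \<le> e * norm (y - s)"
      using \<delta>(1) by auto
  qed (rule bounded_linear_mult_right)
qed

text \<open>The cutoff is \<open>\<phi> x = h 0 (|x|\<^sup>2)\<close>, and \<open>h i\<close> is the radial profile of
  \<open>(-\<Delta>)\<^sup>i \<phi>\<close>; the functions \<open>h1 i\<close> and \<open>h2 i\<close> are its first two derivatives.\<close>
locale radial_cutoff =
  fixes d p :: real and m :: nat and h h1 h2 :: "nat \<Rightarrow> real \<Rightarrow> real" and C :: real
  assumes C_pos: "0 < C"
    and p_pos: "0 < p"
    and h_deriv: "i < m \<Longrightarrow> (h i has_real_derivative h1 i s) (at s)"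
    and h1_deriv: "i < m \<Longrightarrow> (h1 i has_real_derivative h2 i s) (at s)"
    and continuous_h2: "continuous_on UNIV (h2 i)"
    and continuous_h: "continuous_on UNIV (h i)"
    and h_Suc: "i < m \<Longrightarrow> h (Suc i) s = - (4 * s * h2 i s + 2 * d * h1 i s)"
    and h_0_inner: "s \<le> 1 \<Longrightarrow> h 0 s = 1"
    and h_inner: "0 < i \<Longrightarrow> i \<le> m \<Longrightarrow> s \<le> 1 \<Longrightarrow> h i s = 0"
    and h_outer: "i \<le> m \<Longrightarrow> 2 \<le> s \<Longrightarrow> h i s = 0"
    and h_0_nonneg: "0 \<le> h 0 s"
    and h_0_le_1: "h 0 s \<le> 1"
    and h_m_bound: "\<bar>h m s\<bar> \<le> C * h 0 s powr (1 / p)"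

text \<open>The profile is \<open>(1 - (y - 1) ^ (2 * m + 1)) ^ N\<close> with
  \<open>y = clamp12 s\<close>. The exponent \<open>2 * m + 1\<close> makes it flat enough at 1 to
  be glued to the constant pieces through all \<open>m\<close> Laplacians; the power
  \<open>N\<close> does the same at 2 and also yields the bound on \<open>h m\<close>.\<close>

lemma radial_cutoff_exists:
  fixes d p :: real and m :: nat
  assumes "1 < p"
  obtains h h1 h2 C where "radial_cutoff d p m h h1 h2 C"
proof -
  obtain N where N: "2 * real m * p / (p - 1) < real N" using reals_Archimedean2 by blast
  have Np: "real N / p < real N - 2 * real m"
  proof -
    have "2 * real m * p < real N * (p - 1)" using N assms by (simp add: field_simps)
    then show ?thesis using assms by (simp add: field_simps)
  qed
  moreover have "0 \<le> real N / p" using assms by simp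
  ultimately have N2m: "2 * m < N" by linarith
  \<comment> \<open>By the choice of \<open>N\<close>, a zero of order \<open>N - 2 * m\<close> at \<open>2\<close> beats the \<open>p\<close>-th root of one
    of order \<open>N\<close>.\<close>
  define w :: "real poly" where "w = 1 - [:-1, 1:] ^ (2 * m + 1)"
  define Q where "Q i = (radial_neg_laplacian d ^^ i) (w ^ N)" for i
  have Q0: "poly (Q 0) y = (1 - (y - 1) ^ (2 * m + 1)) ^ N" for y
    by (simp add: Q_def w_def poly_power algebra_simps)
  have QSuc: "Q (Suc i) = radial_neg_laplacian d (Q i)" for i by (simp add: Q_def)
  \<comment> \<open>\<open>w\<close> has a root at 2, so \<open>Q 0\<close> vanishes there to order
    \<open>N\<close>, and each radial Laplacian costs two orders. The subtraction is not truncated,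
    as \<open>2 * m < N\<close>.\<close>
  have Q2: "[:- 2, 1:] ^ (N - 2 * i) dvd Q i" if "i \<le> m" for i
    using that
  proof (induction i)
    case 0
    have "poly w 2 = 0" by (simp add: w_def poly_power)
    then have "[:- 2, 1:] dvd w" by (simp add: poly_eq_0_iff_dvd)
    then show ?case by (simp add: Q_def dvd_power_same)
  next
    case (Suc i)
    then have "N - 2 * i = Suc (Suc (N - 2 * Suc i))" using N2m by simp
    with Suc show ?case
      unfolding QSuc by (metis Suc_leD linear_power_dvd_pderiv linear_power_dvd_radial)
  qed
  \<comment> \<open>\<open>Q 0\<close> equals 1 at 1, so the induction tracks the derivative; the
    polynomial itself vanishes there only after one application of the operator.\<close>
  have Q1: "[:- 1, 1:] ^ (2 * m - 2 * i) dvd pderiv (Q i) \<and>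
      (0 < i \<longrightarrow> [:- 1, 1:] ^ (2 * m - 2 * i + 1) dvd Q i)" if "i \<le> m" for i
    using that
  proof (induction i)
    case 0
    have "[:- 1, 1:] ^ (2 * m) dvd pderiv w"
      unfolding w_def pderiv_diff by (simp add: linear_power_dvd_pderiv del: power_Suc)
    then have "[:- 1, 1:] ^ (2 * m) dvd pderiv (w ^ N)"
      by (simp add: pderiv_power dvd_smult)
    then show ?case by (simp add: Q_def)
  next
    case (Suc i)
    then have e: "2 * m - 2 * i = Suc (Suc (2 * m - 2 * Suc i))" by simp
    from Suc have "[:- 1, 1:] ^ Suc (Suc (2 * m - 2 * Suc i)) dvd pderiv (Q i)" unfolding e[symmetric] by simp
    then have "[:- 1, 1:] ^ Suc (2 * m - 2 * Suc i) dvd Q (Suc i)"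
      unfolding QSuc by (rule linear_power_dvd_radial)
    with linear_power_dvd_pderiv[OF this] show ?case by simp
  qed
  \<comment> \<open>The vanishing of two derivatives at both junctions lets
    \<open>DERIV_poly_clamp12\<close> be applied to \<open>Q i\<close> and again to its
    derivative.\<close>
  have zero1: "poly (pderiv (Q i)) 1 = 0" "poly (pderiv (pderiv (Q i))) 1 = 0" if "i < m" for i
  proof -
    have "2 * m - 2 * i = Suc (2 * m - 2 * i - 1)" using that by simp
    then have "[:- 1, 1:] ^ Suc (2 * m - 2 * i - 1) dvd pderiv (Q i)" using Q1[of i] that by (metis less_imp_le)
    from linear_power_dvd_pderiv[OF this] this
    show "poly (pderiv (Q i)) 1 = 0" "poly (pderiv (pderiv (Q i))) 1 = 0"
      using that by (auto intro: poly_eq_0_if_linear_power_dvd)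
  qed
  have zero2: "poly (pderiv (Q i)) 2 = 0" "poly (pderiv (pderiv (Q i))) 2 = 0" if "i < m" for i
  proof -
    have "N - 2 * i = Suc (Suc (N - 2 * i - 2))" using that N2m by simp
    then have 1: "[:- 2, 1:] ^ Suc (Suc (N - 2 * i - 2)) dvd Q i"
      using Q2[of i] that by (metis less_imp_le)
    from linear_power_dvd_pderiv[OF 1] linear_power_dvd_pderiv[OF linear_power_dvd_pderiv[OF 1]]
    show "poly (pderiv (Q i)) 2 = 0" "poly (pderiv (pderiv (Q i))) 2 = 0"
      using that N2m by (auto intro: poly_eq_0_if_linear_power_dvd)
  qed
  define h where "h i s = poly (Q i) (clamp12 s)" for i s
  define h1 where "h1 i s = poly (pderiv (Q i)) (clamp12 s)" for i s
  define h2 where "h2 i s = poly (pderiv (pderiv (Q i))) (clamp12 s)" for i s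
  \<comment> \<open>The constant \<open>C\<close> comes from a bound for this cofactor on [1, 2];
    the maximum with 1 keeps it positive.\<close>
  obtain r where r: "Q m = [:- 2, 1:] ^ (N - 2 * m) * r" using Q2[of m] by (auto elim: dvdE)
  have "compact (poly r ` {1..2})"
    by (intro compact_continuous_image continuous_intros compact_Icc)
  then obtain B where B: "\<forall>z\<in>poly r ` {1..2}. norm z \<le> B"
    by (meson compact_imp_bounded bounded_iff)
  define C where "C = max 1 B"
  have y0: "0 \<le> (clamp12 s - 1) ^ (2 * m + 1)" "(clamp12 s - 1) ^ (2 * m + 1) \<le> clamp12 s - 1" for s
    using clamp12_bounds[of s] power_decreasing[of 1 "2 * m + 1" "clamp12 s - 1"] by auto
  \<comment> \<open>For y in [1, 2] a power of y - 1 is at most y - 1, so the base of the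
    \<open>N\<close>-th power is at least 2 - y. Hence the cutoff decays at 2 no faster than (2 -
    y)^N.\<close>
  have h0: "(2 - clamp12 s) ^ N \<le> h 0 s" "0 \<le> h 0 s" "h 0 s \<le> 1" for s
    unfolding h_def Q0 using y0[of s] clamp12_bounds[of s]
    by (auto intro!: power_mono zero_le_power power_le_one)
  show thesis
  proof (rule that[of h h1 h2 C], unfold_locales)
    show "0 < C" "0 < p" using assms by (simp_all add: C_def)
    show "(h i has_real_derivative h1 i s) (at s)" if "i < m" for i s
      unfolding h_def[abs_def] h1_def using zero1[OF that] zero2[OF that] by (intro DERIV_poly_clamp12)
    show "(h1 i has_real_derivative h2 i s) (at s)" if "i < m" for i s
      unfolding h1_def[abs_def] h2_def using zero1[OF that] zero2[OF that] by (intro DERIV_poly_clamp12)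
    show "continuous_on UNIV (h2 i)" "continuous_on UNIV (h i)" for i
      unfolding h2_def[abs_def] h_def[abs_def] by (intro continuous_intros)+
    show "h (Suc i) s = - (4 * s * h2 i s + 2 * d * h1 i s)" if "i < m" for i s
    proof -
      \<comment> \<open>The recursion has the factor \<open>s\<close>, the polynomial operator the
        factor \<open>clamp12 s\<close>; where the two differ, the second derivative is 0.\<close>
      have "s = clamp12 s \<or> clamp12 s = 1 \<or> clamp12 s = 2" by (auto simp: clamp12_def)
      then have "s * h2 i s = clamp12 s * h2 i s"
        using zero1(2)[OF that] zero2(2)[OF that] unfolding h2_def by (metis mult_zero_right)
      then show ?thesis
        unfolding h_def QSuc h1_def h2_def radial_neg_laplacian_def by (simp add: algebra_simps)
    qed
    show "h 0 s = 1" if "s \<le> 1" for s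
      using that by (simp add: h_def Q0 clamp12_def)
    show "h i s = 0" if "0 < i" "i \<le> m" "s \<le> 1" for i s
    proof -
      have "poly (Q i) 1 = 0"
        using Q1[of i] that by (auto intro: poly_eq_0_if_linear_power_dvd)
      then show ?thesis using that by (simp add: h_def clamp12_def)
    qed
    show "h i s = 0" if "i \<le> m" "2 \<le> s" for i s
    proof -
      have "poly (Q i) 2 = 0"
        using Q2[of i] that N2m by (auto intro: poly_eq_0_if_linear_power_dvd)
      then show ?thesis using that by (simp add: h_def clamp12_def)
    qed
    show "0 \<le> h 0 s" "h 0 s \<le> 1" for s by (rule h0)+
    show "\<bar>h m s\<bar> \<le> C * h 0 s powr (1 / p)" for s
    proof (cases "clamp12 s = 2")
      case True
      then have "h m s = 0"
        unfolding h_def using Q2[of m] N2m by (auto intro: poly_eq_0_if_linear_power_dvd)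
      then show ?thesis by (simp add: C_def)
    next
      case False
      \<comment> \<open>The chain is |h m s| \<le> C t^(N - 2m) \<le> C t^(N/p) \<le> C (h 0
        s)^(1/p), the middle step because 0 < t \<le> 1 and N/p < N - 2m.\<close>
      define t where "t = 2 - clamp12 s"
      have t: "0 < t" "t \<le> 1" using False clamp12_bounds[of s] by (auto simp: t_def)
      have "t ^ (N - 2 * m) = t powr (real N - 2 * real m)"
        using t N2m by (simp add: powr_realpow[symmetric] of_nat_diff)
      also have "\<dots> \<le> t powr (real N * (1 / p))"
        using t Np by (intro powr_mono') auto
      also have "\<dots> = (t ^ N) powr (1 / p)"
        using t by (simp only: powr_powr[symmetric] powr_realpow)
      also have "\<dots> \<le> h 0 s powr (1 / p)"
        using h0(1)[of s] t assms by (intro powr_mono2) (auto simp: t_def)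
      finally have t_bound: "t ^ (N - 2 * m) \<le> h 0 s powr (1 / p)" .
      have "\<bar>h m s\<bar> = \<bar>poly r (clamp12 s)\<bar> * t ^ (N - 2 * m)"
        using clamp12_bounds[of s]
        by (simp add: h_def r poly_power abs_mult power_abs t_def)
      also have "\<dots> \<le> C * h 0 s powr (1 / p)"
        using B clamp12_bounds[of s] t t_bound by (intro mult_mono) (auto simp: C_def le_max_iff_disj)
      finally show ?thesis .
    qed
  qed
qed

subsection \<open>The capacity estimate\<close>

text \<open>An elementary form of Young's inequality. The threshold
  \<open>(2 * B / w) powr (1 / (p - 1))\<close> is where \<open>B * t\<close> and half of
  \<open>w * t powr p\<close> balance: below it the constant dominates, above it the power
  does.\<close>

lemma absorb_lower_power:
  fixes B t w p :: real
  assumes "1 < p" "0 < w" "0 \<le> B" "0 \<le> t"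
  shows "B * t \<le> w * t powr p / 2 + B * (2 * B / w) powr (1 / (p - 1))"
proof (cases "t \<le> (2 * B / w) powr (1 / (p - 1))")
  case True
  have "0 \<le> w * t powr p / 2" using assms by simp
  moreover have "B * t \<le> B * (2 * B / w) powr (1 / (p - 1))"
    using True assms by (intro mult_left_mono)
  ultimately show ?thesis by linarith
next
  case False
  have t: "0 < t" using False powr_ge_zero[of "2 * B / w" "1 / (p - 1)"] by linarith
  have "((2 * B / w) powr (1 / (p - 1))) powr (p - 1) \<le> t powr (p - 1)"
    using False assms by (intro powr_mono2) auto
  then have "2 * B / w \<le> t powr (p - 1)"
    using assms by (simp add: powr_powr)
  then have "B \<le> w * t powr (p - 1) / 2" using assms by (simp add: field_simps)
  then have "B * t \<le> w * t powr (p - 1) / 2 * t" using t by (intro mult_right_mono) auto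
  also have "\<dots> = w * t powr p / 2"
    using powr_add[of t "p - 1" 1] t by simp
  finally show ?thesis using assms
    by (smt (verit) mult_nonneg_nonneg powr_ge_zero)
qed

section \<open>Rescaled cutoffs and their radial profiles\<close>

context radial_cutoff
begin

text \<open>The profile, as a function of s = |x|^2, of the \<open>i\<close>-th power of the
  negative Laplacian applied to the cutoff \<phi>(x/R); every Laplacian contributes a factor R^(-2).
  The next two definitions are its derivatives in \<open>s\<close>.\<close>

definition scaled :: "real \<Rightarrow> nat \<Rightarrow> real \<Rightarrow> real" where
  "scaled R i s = h i (s / R\<^sup>2) / R ^ (2 * i)"

definition scaled1 :: "real \<Rightarrow> nat \<Rightarrow> real \<Rightarrow> real" where
  "scaled1 R i s = h1 i (s / R\<^sup>2) / R ^ (2 * i + 2)"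

definition scaled2 :: "real \<Rightarrow> nat \<Rightarrow> real \<Rightarrow> real" where
  "scaled2 R i s = h2 i (s / R\<^sup>2) / R ^ (2 * i + 4)"

lemma scaled_deriv:
  assumes "0 < R" "i < m"
  shows "(scaled R i has_real_derivative scaled1 R i s) (at s)"
proof -
  have "((\<lambda>s. s / R\<^sup>2) has_real_derivative 1 / R\<^sup>2) (at s)"
    by (rule DERIV_cdivide[OF DERIV_ident])
  note * = DERIV_cdivide[OF DERIV_chain2[OF h_deriv[OF assms(2)] this], of "R ^ (2 * i)"]
  show ?thesis
    unfolding scaled_def[abs_def]
    by (rule DERIV_cong[OF *]) (simp add: scaled1_def power_add power2_eq_square mult_ac)
qed

lemma scaled1_deriv:
  assumes "0 < R" "i < m"
  shows "(scaled1 R i has_real_derivative scaled2 R i s) (at s)"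
proof -
  have "((\<lambda>s. s / R\<^sup>2) has_real_derivative 1 / R\<^sup>2) (at s)"
    by (rule DERIV_cdivide[OF DERIV_ident])
  note * = DERIV_cdivide[OF DERIV_chain2[OF h1_deriv[OF assms(2)] this], of "R ^ (2 * i + 2)"]
  show ?thesis
    unfolding scaled1_def[abs_def]
    by (rule DERIV_cong[OF *]) (simp add: scaled2_def power_add power4_eq_xxxx power2_eq_square mult_ac)
qed

lemma continuous_on_scaled:
  assumes "0 < R"
  shows "continuous_on UNIV (scaled R i)" "continuous_on UNIV (scaled2 R i)"
  unfolding scaled_def[abs_def] scaled2_def[abs_def]
  by (intro continuous_on_divide continuous_on_compose2[OF continuous_h]
      continuous_on_compose2[OF continuous_h2] continuous_on_const continuous_on_id; use assms in simp)+

lemma scaled_Suc: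
  assumes "0 < R" "i < m"
  shows "scaled R (Suc i) s = - (4 * s * scaled2 R i s + 2 * d * scaled1 R i s)"
proof -
  have e: "R ^ (2 * i + 4) = R ^ (2 * i + 2) * R\<^sup>2" "R ^ (2 * Suc i) = R ^ (2 * i + 2)"
    by (simp_all add: power_add power4_eq_xxxx power2_eq_square)
  show ?thesis
    unfolding scaled_def scaled1_def scaled2_def h_Suc[OF assms(2)] e
    using assms(1) by (simp add: field_simps)
qed

lemma scaled_0_inner: "0 < R \<Longrightarrow> s \<le> R\<^sup>2 \<Longrightarrow> scaled R 0 s = 1"
  by (simp add: scaled_def h_0_inner)

lemma scaled_inner: "0 < R \<Longrightarrow> 0 < i \<Longrightarrow> i \<le> m \<Longrightarrow> s \<le> R\<^sup>2 \<Longrightarrow> scaled R i s = 0"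
  by (simp add: scaled_def h_inner)

lemma scaled_outer: "0 < R \<Longrightarrow> i \<le> m \<Longrightarrow> 2 * R\<^sup>2 \<le> s \<Longrightarrow> scaled R i s = 0"
  by (simp add: scaled_def h_outer pos_le_divide_eq)

lemma scaled_0_bounds: "0 \<le> scaled R 0 s" "scaled R 0 s \<le> 1"
  by (simp_all add: scaled_def h_0_nonneg h_0_le_1)

lemma scaled_m_bound:
  assumes "0 < R"
  shows "\<bar>scaled R m s\<bar> \<le> C / R ^ (2 * m) * scaled R 0 s powr (1 / p)"
  using divide_right_mono[OF h_m_bound[of "s / R\<^sup>2"], of "R ^ (2 * m)"] assms
  by (simp add: scaled_def)

section \<open>Integrals against the top-order profile and their limit at the origin\<close>

lemma scaled_integrable:
  fixes g :: "'a::euclidean_space \<Rightarrow> real"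
  assumes "continuous_on (- {0}) g" "0 < R" "0 < m"
  shows "integrable lborel (\<lambda>x. g x * scaled R m ((norm x)\<^sup>2))"
  by (rule integrable_radial_cutoff[OF assms(1) continuous_on_scaled(1)[OF assms(2)], of "R\<^sup>2" "2 * R\<^sup>2"])
    (use assms scaled_inner[of R m] scaled_outer[of R m] in force)+

text \<open>The integrand is the negative Laplacian of the profile of index \<open>m - 1\<close>,
  tested against the constant 1. As \<open>2 \<le> m\<close>, that index is positive, so this
  profile is supported in an annulus and Green's identity applies.\<close>

lemma integral_scaled_eq_0:
  assumes "0 < R" "2 \<le> m" "d = DIM('a::euclidean_space)"
  shows "integral\<^sup>L lborel (\<lambda>x::'a. scaled R m ((norm x)\<^sup>2)) = 0"
proof -
  define i where "i = m - 1"
  have i: "i < m" "m = Suc i" "0 < i" using assms by (auto simp: i_def)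
  have supp: "scaled R i s = 0" if "s \<notin> {R\<^sup>2..2 * R\<^sup>2}" for s
    using that assms(1) i scaled_inner[of R i s] scaled_outer[of R i s] by force
  have "integral\<^sup>L lborel (\<lambda>x::'a. 1 * (4 * (norm x)\<^sup>2 * scaled2 R i ((norm x)\<^sup>2)
      + 2 * DIM('a) * scaled1 R i ((norm x)\<^sup>2))) = 0"
    by (subst integral_laplacian_radial[where \<alpha> = "R\<^sup>2" and \<beta> = "2 * R\<^sup>2", symmetric,
          OF C_k_on_const scaled_deriv[OF assms(1) i(1)] scaled1_deriv[OF assms(1) i(1)]
          continuous_on_scaled(2)[OF assms(1)] supp])
      (use assms in \<open>auto simp: laplacian_const\<close>)
  then have "integral\<^sup>L lborel (\<lambda>x::'a. - (4 * (norm x)\<^sup>2 * scaled2 R i ((norm x)\<^sup>2)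
      + 2 * DIM('a) * scaled1 R i ((norm x)\<^sup>2))) = 0"
    by (subst Bochner_Integration.integral_minus) simp
  then show ?thesis
    by (subst i(2)) (simp add: scaled_Suc[OF assms(1) i(1)] assms(3))
qed

text \<open>By the zero mean, \<open>u\<close> may be replaced by \<open>u x - u 0\<close>, which is
  small near the origin. The profile is at most \<open>C / \<epsilon> ^ (2 * m)\<close> on a ball of
  volume \<open>W * \<epsilon> ^ (2 * m)\<close>; the powers of \<epsilon> cancel because the order
  equals the dimension.\<close>

lemma integral_scaled_tendsto_0:
  fixes u :: "'a::euclidean_space \<Rightarrow> real"
  assumes u: "continuous_on UNIV u" and m: "2 \<le> m" "DIM('a) = 2 * m" "d = DIM('a)"
  shows "((\<lambda>\<epsilon>. integral\<^sup>L lborel (\<lambda>x. u x * scaled \<epsilon> m ((norm x)\<^sup>2))) \<longlongrightarrow> 0) (at_right 0)"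
proof (rule tendstoI)
  fix e :: real assume "0 < e"
  define W where "W = unit_ball_vol (real DIM('a)) * sqrt 2 ^ DIM('a)"
  have W: "0 < W" by (auto simp: W_def)
  define \<delta> where "\<delta> = e / (2 * (C * W))"
  have \<delta>: "0 < \<delta>" "\<delta> * (C * W) < e" using \<open>0 < e\<close> W C_pos by (auto simp: \<delta>_def)
  obtain r where r: "0 < r" "\<And>x. norm x < r \<Longrightarrow> \<bar>u x - u 0\<bar> < \<delta>"
    using u \<delta>(1) unfolding continuous_on_iff dist_real_def by (metis UNIV_I dist_0_norm dist_commute)
  have "\<bar>integral\<^sup>L lborel (\<lambda>x. u x * scaled \<epsilon> m ((norm x)\<^sup>2))\<bar> < e"
    if \<epsilon>: "0 < \<epsilon>" "\<epsilon> < r / sqrt 2" for \<epsilon>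
  proof -
    let ?s = "\<lambda>x::'a. scaled \<epsilon> m ((norm x)\<^sup>2)"
    let ?K = "cball 0 (sqrt 2 * \<epsilon>) :: 'a set"
    have cont: "continuous_on (- {0}) u" by (rule continuous_on_subset[OF u]) simp
    have int: "integrable lborel (\<lambda>x. u x * ?s x)" "integrable lborel (\<lambda>x. u 0 * ?s x)"
      using scaled_integrable[OF cont \<epsilon>(1)]
        scaled_integrable[OF continuous_on_const \<epsilon>(1), of "u 0"] m by auto
    have bound: "norm (u x * ?s x - u 0 * ?s x) \<le> \<delta> * (C / \<epsilon> ^ (2 * m)) * indicator ?K x" for x
    proof (cases "x \<in> ?K")
      case True
      have "sqrt 2 * \<epsilon> < r" using \<epsilon> by (simp add: field_simps)
      then have "\<bar>u x - u 0\<bar> \<le> \<delta>" using True r(2)[of x] by force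
      moreover have "\<bar>?s x\<bar> \<le> C / \<epsilon> ^ (2 * m)"
      proof -
        have "scaled \<epsilon> 0 ((norm x)\<^sup>2) powr (1 / p) \<le> 1"
          using scaled_0_bounds[of \<epsilon> "(norm x)\<^sup>2"] p_pos by (intro powr_le1) auto
        then have "C / \<epsilon> ^ (2 * m) * scaled \<epsilon> 0 ((norm x)\<^sup>2) powr (1 / p) \<le> C / \<epsilon> ^ (2 * m) * 1"
          using C_pos \<epsilon> by (intro mult_left_mono) auto
        then show ?thesis using scaled_m_bound[OF \<epsilon>(1), of "(norm x)\<^sup>2"] by linarith
      qed
      ultimately have "\<bar>u x - u 0\<bar> * \<bar>?s x\<bar> \<le> \<delta> * (C / \<epsilon> ^ (2 * m))"
        using \<delta> by (intro mult_mono) auto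
      then show ?thesis using True by (simp flip: abs_mult left_diff_distrib)
    next
      case False
      then have "(sqrt 2 * \<epsilon>)\<^sup>2 \<le> (norm x)\<^sup>2" using \<epsilon> by (intro power_mono) auto
      then have "?s x = 0" using \<epsilon> by (intro scaled_outer) (auto simp: power_mult_distrib)
      then show ?thesis using False by simp
    qed
    have K: "integral\<^sup>L lborel (indicator ?K) = W * \<epsilon> ^ (2 * m)"
      using \<epsilon> m by (simp add: W_def content_cball power_mult_distrib)
    have "integral\<^sup>L lborel (\<lambda>x. u x * ?s x) = integral\<^sup>L lborel (\<lambda>x. u x * ?s x - u 0 * ?s x)"
      using int integral_scaled_eq_0[where 'a = 'a, OF \<epsilon>(1) m(1,3)] by simp
    also have "\<bar>\<dots>\<bar> \<le> integral\<^sup>L lborel (\<lambda>x. \<delta> * (C / \<epsilon> ^ (2 * m)) * indicator ?K x)"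
      unfolding real_norm_def[symmetric]
      by (rule Bochner_Integration.integral_norm_bound_integral[OF Bochner_Integration.integrable_diff[OF int] _ bound])
        (use emeasure_lborel_cball_finite[of "0::'a" "sqrt 2 * \<epsilon>"] in
          \<open>auto simp: infinity_ennreal_def intro!: integrable_mult_right integrable_real_indicator\<close>)
    also have "\<dots> = \<delta> * (C * W)" using K \<epsilon> by simp
    finally show ?thesis using \<delta>(2) by linarith
  qed
  then show "\<forall>\<^sub>F \<epsilon> in at_right 0. dist (integral\<^sup>L lborel (\<lambda>x. u x * scaled \<epsilon> m ((norm x)\<^sup>2))) 0 < e"
    unfolding eventually_at_right_field using r(1) by (intro exI[of _ "r / sqrt 2"]) auto
qed

text \<open>For |x| < \<epsilon> both profiles are 1 if \<open>i = 0\<close> and both are 0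
  otherwise; beyond the larger support both are 0. The difference is therefore an admissible test
  function away from the origin.\<close>

lemma scaled_diff_eq_0:
  assumes "0 < \<epsilon>" "0 < R" "2 * \<epsilon>\<^sup>2 \<le> R\<^sup>2" "i \<le> m" "s \<notin> {\<epsilon>\<^sup>2..2 * R\<^sup>2}"
  shows "scaled R i s - scaled \<epsilon> i s = 0"
proof -
  have \<epsilon>R: "\<epsilon>\<^sup>2 \<le> R\<^sup>2" using assms(3) zero_le_power2[of \<epsilon>] by linarith
  show ?thesis
  proof (cases "s < \<epsilon>\<^sup>2")
    case True
    then have "s \<le> \<epsilon>\<^sup>2" "s \<le> R\<^sup>2" using \<epsilon>R by auto
    then show ?thesis using assms
      by (cases "i = 0") (simp_all add: scaled_0_inner scaled_inner)
  next
    case False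
    then have "2 * R\<^sup>2 \<le> s" "2 * \<epsilon>\<^sup>2 \<le> s" using assms(5) \<epsilon>R by auto
    then show ?thesis using assms by (simp add: scaled_outer)
  qed
qed

text \<open>The relation between \<epsilon> and \<open>R\<close> places the support of the inner
  cutoff inside the region where the outer one equals 1.\<close>

lemma scaled_0_mono:
  assumes "0 < \<epsilon>" "0 < R" "2 * \<epsilon>\<^sup>2 \<le> R\<^sup>2"
  shows "scaled \<epsilon> 0 s \<le> scaled R 0 s"
proof (cases "s \<le> R\<^sup>2")
  case True
  then show ?thesis using scaled_0_bounds(2)[of \<epsilon> s] assms by (simp add: scaled_0_inner)
next
  case False
  then have "2 * \<epsilon>\<^sup>2 \<le> s" using assms(3) by simp
  then show ?thesis using scaled_0_bounds(1)[of R s] assms(1) by (simp add: scaled_outer)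
qed

lemma scaled_diff_integrable:
  fixes g :: "'a::euclidean_space \<Rightarrow> real"
  assumes "continuous_on (- {0}) g" "0 < \<epsilon>" "0 < R" "2 * \<epsilon>\<^sup>2 \<le> R\<^sup>2"
  shows "integrable lborel (\<lambda>x. g x * (scaled R 0 ((norm x)\<^sup>2) - scaled \<epsilon> 0 ((norm x)\<^sup>2)))"
proof (rule integrable_radial_cutoff[OF assms(1)])
  show "continuous_on UNIV (\<lambda>s. scaled R 0 s - scaled \<epsilon> 0 s)"
    using assms by (intro continuous_on_diff continuous_on_scaled)
  show "scaled R 0 s - scaled \<epsilon> 0 s = 0" if "s \<notin> {\<epsilon>\<^sup>2..2 * R\<^sup>2}" for s
    by (rule scaled_diff_eq_0[OF assms(2-4) _ that]) simp
  show "0 < \<epsilon>\<^sup>2" using assms by simp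
qed

text \<open>After all Laplacians are moved to the cutoffs, the outer term is at most half of the
  left-hand side plus a remainder. Absorbing that half produces the factors 2.\<close>

lemma integral_neg_laplacian_power_le:
  fixes u :: "'a::euclidean_space \<Rightarrow> real" and a :: real
  assumes u: "C_k_on (2 * m) u (- {0})" and nonneg: "\<And>x. 0 \<le> u x"
    and m: "2 \<le> m" "DIM('a) = 2 * m" "d = DIM('a)" and p: "1 < p"
    and eq: "\<And>x. x \<noteq> 0 \<Longrightarrow> neg_laplacian_power m u x = norm x powr (- a) * u x powr p"
    and \<epsilon>: "0 < \<epsilon>" "2 * \<epsilon>\<^sup>2 \<le> R\<^sup>2" "0 < R"
  shows "integral\<^sup>L lborel (\<lambda>x. neg_laplacian_power m u x *
        (scaled R 0 ((norm x)\<^sup>2) - scaled \<epsilon> 0 ((norm x)\<^sup>2)))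
    \<le> 2 * (unit_ball_vol (real DIM('a)) * sqrt 2 ^ DIM('a))
        * (C * (2 * C * max 1 (sqrt 2 powr a)) powr (1 / (p - 1)))
        * R powr ((a - DIM('a)) / (p - 1))
      + 2 * \<bar>integral\<^sup>L lborel (\<lambda>x. u x * scaled \<epsilon> m ((norm x)\<^sup>2))\<bar>"
proof -
  let ?N = "\<lambda>x::'a. (norm x)\<^sup>2"
  let ?f = "neg_laplacian_power m u"
  let ?K = "cball 0 (sqrt 2 * R) :: 'a set"
  define W where "W = unit_ball_vol (real DIM('a)) * sqrt 2 ^ DIM('a)"
  define c where "c = max 1 (sqrt 2 powr a)"
  \<comment> \<open>The remainder in \<open>absorb_lower_power\<close> for
    \<open>B = C / R ^ (2 * m)\<close> and weight |x|^(-a) is at most \<open>E / R ^ (2 * m)\<close>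
    on the annulus, since |x|^a \<le> c R^a there. Integration over a ball of volume
    \<open>W * R ^ (2 * m)\<close> leaves \<open>W * E\<close>.\<close>
  define E where "E = C * (2 * C * c) powr (1 / (p - 1)) * R powr ((a - DIM('a)) / (p - 1))"
  define \<psi> where "\<psi> i s = scaled R i s - scaled \<epsilon> i s" for i s
  have E: "0 \<le> E" using C_pos by (simp add: E_def)
  have supp: "\<psi> i s = 0" if "i \<le> m" "s \<notin> {\<epsilon>\<^sup>2..2 * R\<^sup>2}" for i s
    unfolding \<psi>_def by (rule scaled_diff_eq_0[OF \<epsilon>(1,3,2) that])
  have \<psi>_nonneg: "0 \<le> \<psi> 0 s" for s
    unfolding \<psi>_def using scaled_0_mono[OF \<epsilon>(1,3,2)] by simp
  have cont: "continuous_on (- {0}) u" using C_k_on_mono[OF u, of 0] by simp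
  have f_cont: "continuous_on (- {0}) ?f"
    using C_k_on_neg_laplacian_power[of "- {0}" m 0 u] u by (simp add: open_Compl)
  have f_int: "integrable lborel (\<lambda>x. ?f x * \<psi> 0 (?N x))"
    unfolding \<psi>_def by (rule scaled_diff_integrable[OF f_cont \<epsilon>(1,3,2)])
  have R_int: "integrable lborel (\<lambda>x. u x * scaled R m (?N x))"
    and \<epsilon>_int: "integrable lborel (\<lambda>x. u x * scaled \<epsilon> m (?N x))"
    using scaled_integrable[OF cont] \<epsilon> m by auto
  have "integral\<^sup>L lborel (\<lambda>x. ?f x * \<psi> 0 (?N x)) = integral\<^sup>L lborel (\<lambda>x. u x * \<psi> m (?N x))"
  proof (rule integral_neg_laplacian_power_radial[OF u, where \<alpha> = "\<epsilon>\<^sup>2" and \<beta> = "2 * R\<^sup>2"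
        and \<psi>' = "\<lambda>i s. scaled1 R i s - scaled1 \<epsilon> i s"
        and \<psi>'' = "\<lambda>i s. scaled2 R i s - scaled2 \<epsilon> i s"])
    show "(\<psi> i has_real_derivative scaled1 R i s - scaled1 \<epsilon> i s) (at s)" if "i < m" for i s
      unfolding \<psi>_def[abs_def] using \<epsilon> that by (intro DERIV_diff scaled_deriv)
    show "((\<lambda>s. scaled1 R i s - scaled1 \<epsilon> i s) has_real_derivative scaled2 R i s - scaled2 \<epsilon> i s) (at s)"
      if "i < m" for i s
      using \<epsilon> that by (intro DERIV_diff scaled1_deriv)
    show "continuous_on UNIV (\<lambda>s. scaled2 R i s - scaled2 \<epsilon> i s)" for i
      using \<epsilon> by (intro continuous_on_diff continuous_on_scaled)
    show "\<psi> (Suc i) s = - (4 * s * (scaled2 R i s - scaled2 \<epsilon> i s)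
        + 2 * DIM('a) * (scaled1 R i s - scaled1 \<epsilon> i s))" if "i < m" for i s
      unfolding \<psi>_def scaled_Suc[OF \<epsilon>(1) that] scaled_Suc[OF \<epsilon>(3) that] m(3) by (simp add: algebra_simps)
  qed (use supp \<epsilon> in auto)
  also have "\<dots> = integral\<^sup>L lborel (\<lambda>x. u x * scaled R m (?N x))
      - integral\<^sup>L lborel (\<lambda>x. u x * scaled \<epsilon> m (?N x))"
    unfolding \<psi>_def right_diff_distrib using R_int \<epsilon>_int by simp
  finally have identity: "integral\<^sup>L lborel (\<lambda>x. ?f x * \<psi> 0 (?N x)) = \<dots>" .

  \<comment> \<open>Only the annulus R < |x| < sqrt 2 R matters, as the top-order profile vanishes
    elsewhere. On it the inner cutoff is already 0, so \<open>\<psi> 0\<close> is the outer cutoff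
    \<open>H\<close>.\<close>
  have "u x * scaled R m (?N x) \<le> ?f x * \<psi> 0 (?N x) / 2 + E / R ^ (2 * m) * indicator ?K x" for x
  proof (cases "R\<^sup>2 < ?N x \<and> ?N x < 2 * R\<^sup>2")
    case True
    have x: "R < norm x" using True \<epsilon> power_less_imp_less_base[of R 2 "norm x"] by simp
    have "?N x < (sqrt 2 * R)\<^sup>2" using True by (simp add: power_mult_distrib)
    then have x': "norm x < sqrt 2 * R" using \<epsilon> power_less_imp_less_base[of "norm x" 2 "sqrt 2 * R"] by simp
    have x0: "x \<noteq> 0" using x \<epsilon> by auto
    define H where "H = scaled R 0 (?N x)"
    have H: "0 \<le> H" "\<psi> 0 (?N x) = H"
      using True \<epsilon> scaled_0_bounds by (auto simp: H_def \<psi>_def scaled_outer)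
    define B where "B = C / R ^ (2 * m)"
    have B: "0 < B" using C_pos \<epsilon> by (simp add: B_def)
    have BR: "B = C * R powr (- DIM('a))"
      using powr_realpow[OF \<epsilon>(3), of "2 * m"] m(2) by (simp add: B_def powr_minus divide_inverse)
    \<comment> \<open>The sign of \<open>a\<close> decides which end of the annulus gives the larger
      value; the maximum in \<open>c\<close> covers both.\<close>
    have "norm x powr a \<le> c * R powr a"
    proof (cases "0 \<le> a")
      case True
      then have "norm x powr a \<le> (sqrt 2 * R) powr a" using x' by (intro powr_mono2) auto
      also have "\<dots> = sqrt 2 powr a * R powr a" using \<epsilon> by (simp add: powr_mult)
      also have "\<dots> \<le> c * R powr a" by (intro mult_right_mono) (auto simp: c_def)
      finally show ?thesis .
    next
      case False
      then have "norm x powr a \<le> R powr a" using x \<epsilon> by (intro powr_mono2') auto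
      also have "\<dots> \<le> c * R powr a" using mult_right_mono[of 1 c "R powr a"] by (simp add: c_def)
      finally show ?thesis .
    qed
    then have "2 * B / norm x powr (- a) \<le> 2 * B * (c * R powr a)"
      using B by (simp add: powr_minus divide_inverse)
    also have "\<dots> = 2 * C * c * R powr (a - DIM('a))"
      by (simp add: BR powr_add[symmetric] algebra_simps)
    finally have "(2 * B / norm x powr (- a)) powr (1 / (p - 1)) \<le> (2 * C * c * R powr (a - DIM('a))) powr (1 / (p - 1))"
      using p B by (intro powr_mono2) auto
    also have "\<dots> = (2 * C * c) powr (1 / (p - 1)) * R powr ((a - DIM('a)) / (p - 1))"
      using C_pos by (simp add: powr_mult powr_powr c_def)
    finally have "B * (2 * B / norm x powr (- a)) powr (1 / (p - 1))
        \<le> B * ((2 * C * c) powr (1 / (p - 1)) * R powr ((a - DIM('a)) / (p - 1)))"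
      using B by (intro mult_left_mono) auto
    then have "B * (2 * B / norm x powr (- a)) powr (1 / (p - 1)) \<le> E / R ^ (2 * m)"
      by (simp add: E_def B_def mult.assoc)
    moreover have "u x * scaled R m (?N x) \<le> B * (u x * H powr (1 / p))"
    proof -
      have "scaled R m (?N x) \<le> B * H powr (1 / p)"
        using scaled_m_bound[OF \<epsilon>(3), of "?N x"] by (simp add: B_def H_def)
      from mult_left_mono[OF this nonneg[of x]] show ?thesis by (simp add: mult_ac)
    qed
    \<comment> \<open>With t = u H^(1/p), the \<open>p\<close>-th power restores exactly one factor
      \<open>H\<close>, so the first term is half of the tested nonlinearity.\<close>
    moreover have "B * (u x * H powr (1 / p)) \<le> norm x powr (- a) * (u x * H powr (1 / p)) powr p / 2
        + B * (2 * B / norm x powr (- a)) powr (1 / (p - 1))"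
      using p x0 B nonneg[of x] by (intro absorb_lower_power) auto
    moreover have "norm x powr (- a) * (u x * H powr (1 / p)) powr p = ?f x * \<psi> 0 (?N x)"
      using p x0 H nonneg[of x] by (simp add: eq powr_mult powr_powr)
    ultimately show ?thesis using x' by simp
  next
    case False
    then have "scaled R m (?N x) = 0"
      using \<epsilon>(3) m(1) scaled_inner[of R m "?N x"] scaled_outer[of R m "?N x"] by linarith
    \<comment> \<open>At the origin the sign of \<open>?f\<close> is unknown, but the test function
      is 0 there.\<close>
    moreover have "0 \<le> ?f x * \<psi> 0 (?N x)"
    proof (cases "x = 0")
      case True
      then show ?thesis using \<epsilon> supp[of 0 0] by simp
    next
      case False
      then show ?thesis using \<psi>_nonneg by (simp add: eq)
    qed
    ultimately show ?thesis using E \<epsilon> by (simp add: indicator_def)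
  qed
  then have "integral\<^sup>L lborel (\<lambda>x. u x * scaled R m (?N x))
      \<le> integral\<^sup>L lborel (\<lambda>x. ?f x * \<psi> 0 (?N x) / 2 + E / R ^ (2 * m) * indicator ?K x)"
    using f_int R_int emeasure_lborel_cball_finite[of "0::'a" "sqrt 2 * R"]
    by (intro integral_mono)
      (auto simp: infinity_ennreal_def intro!: integrable_mult_right integrable_real_indicator
        Bochner_Integration.integrable_add)
  also have "\<dots> = integral\<^sup>L lborel (\<lambda>x. ?f x * \<psi> 0 (?N x)) / 2 + E / R ^ (2 * m) * measure lborel ?K"
    using f_int emeasure_lborel_cball_finite[of "0::'a" "sqrt 2 * R"]
    by (subst Bochner_Integration.integral_add)
      (auto simp: infinity_ennreal_def intro!: integrable_mult_right integrable_real_indicator)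
  also have "E / R ^ (2 * m) * measure lborel ?K = W * E"
    using \<epsilon> m by (simp add: W_def content_cball power_mult_distrib)
  finally have "integral\<^sup>L lborel (\<lambda>x. ?f x * \<psi> 0 (?N x)) \<le> 2 * W * E
      + 2 * \<bar>integral\<^sup>L lborel (\<lambda>x. u x * scaled \<epsilon> m (?N x))\<bar>"
    using identity by linarith
  then show ?thesis
    unfolding \<psi>_def W_def E_def c_def by (simp only: mult.assoc)
qed

text \<open>If \<open>u x0\<close> were positive, the right-hand side of the equation would be at
  least \<open>k\<close> on a ball around \<open>x0\<close>. The tested integral would then exceed a
  fixed \<open>L > 0\<close> for all large \<open>R\<close> and small \<epsilon>, against the
  capacity estimate.\<close>

lemma hardy_henon_eq_0:
  fixes u :: "'a::euclidean_space \<Rightarrow> real" and a :: real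
  assumes u_cont: "continuous_on UNIV u"
    and u: "C_k_on (2 * m) u (- {0})" and nonneg: "\<And>x. 0 \<le> u x"
    and m: "2 \<le> m" "DIM('a) = 2 * m" "d = DIM('a)" and p: "1 < p" and a: "a < DIM('a)"
    and eq: "\<And>x. x \<noteq> 0 \<Longrightarrow> neg_laplacian_power m u x = norm x powr (- a) * u x powr p"
    and x0: "x0 \<noteq> 0"
  shows "u x0 = 0"
proof (rule ccontr)
  assume "u x0 \<noteq> 0"
  let ?N = "\<lambda>x::'a. (norm x)\<^sup>2"
  let ?f = "neg_laplacian_power m u"
  define A where "A R \<epsilon> = integral\<^sup>L lborel (\<lambda>x. ?f x * (scaled R 0 (?N x) - scaled \<epsilon> 0 (?N x)))" for R \<epsilon>
  define J where "J \<epsilon> = integral\<^sup>L lborel (\<lambda>x. u x * scaled \<epsilon> m (?N x))" for \<epsilon>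
  define k where "k = ?f x0 / 2"
  have k: "0 < k" using \<open>u x0 \<noteq> 0\<close> x0 nonneg[of x0] by (simp add: k_def eq)
  have f_cont: "continuous_on (- {0}) ?f"
    using C_k_on_neg_laplacian_power[of "- {0}" m 0 u] u by (simp add: open_Compl)
  then have "isCont ?f x0" using x0 continuous_on_eq_continuous_at[of "- {0}" ?f] by auto
  then obtain \<rho>1 where \<rho>1: "0 < \<rho>1" "\<And>x. dist x x0 < \<rho>1 \<Longrightarrow> \<bar>?f x - ?f x0\<bar> < k"
    using k unfolding continuous_at_eps_delta dist_real_def by metis
  \<comment> \<open>The second bound keeps the ball within |x0|/2 \<le> |x| \<le> 2|x0|, where the
    test function equals 1 once R \<ge> 2|x0| and \<epsilon> \<le> |x0|/4.\<close>
  define \<rho> where "\<rho> = min (\<rho>1 / 2) (norm x0 / 2)"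
  have \<rho>: "0 < \<rho>" "\<rho> < \<rho>1" "\<rho> \<le> norm x0 / 2" using \<rho>1 x0 by (auto simp: \<rho>_def)
  let ?D = "cball x0 \<rho>"
  have D: "k \<le> ?f x" "norm x0 / 2 \<le> norm x" "norm x \<le> 2 * norm x0" if "x \<in> ?D" for x
  proof -
    have "dist x x0 < \<rho>1" using that \<rho> by (simp add: dist_commute)
    then show "k \<le> ?f x" using \<rho>1(2)[of x] unfolding k_def by linarith
    show "norm x0 / 2 \<le> norm x" "norm x \<le> 2 * norm x0"
      using that \<rho> norm_triangle_ineq2[of x0 x] norm_triangle_ineq2[of x x0]
      by (auto simp: dist_norm norm_minus_commute)
  qed
  define L where "L = k * measure lborel ?D"
  have L: "0 < L" using k \<rho> by (simp add: L_def content_cball_pos)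
  have lower: "L \<le> A R \<epsilon>" if R: "2 * norm x0 \<le> R" and \<epsilon>: "0 < \<epsilon>" "\<epsilon> \<le> norm x0 / 4" for R \<epsilon>
  proof -
    have "0 < R" using R x0 by (smt (verit) zero_less_norm_iff)
    have sq: "2 * \<epsilon>\<^sup>2 \<le> (norm x0 / 2)\<^sup>2"
    proof -
      have "\<epsilon>\<^sup>2 \<le> (norm x0 / 4)\<^sup>2" using \<epsilon> by (intro power_mono) auto
      moreover have "(norm x0 / 4)\<^sup>2 = (norm x0)\<^sup>2 / 16" "(norm x0 / 2)\<^sup>2 = (norm x0)\<^sup>2 / 4"
        by (simp_all add: power_divide)
      ultimately show ?thesis using zero_le_power2[of \<epsilon>] by linarith
    qed
    have \<epsilon>R: "2 * \<epsilon>\<^sup>2 \<le> R\<^sup>2"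
    proof -
      have "(norm x0 / 2)\<^sup>2 \<le> R\<^sup>2" using R norm_ge_zero[of x0] by (intro power_mono) linarith+
      with sq show ?thesis by linarith
    qed
    define g where "g s = scaled R 0 s - scaled \<epsilon> 0 s" for s
    have int: "integrable lborel (\<lambda>x. ?f x * g (?N x))"
      unfolding g_def by (rule scaled_diff_integrable[OF f_cont \<epsilon>(1) \<open>0 < R\<close> \<epsilon>R])
    have "k * indicator ?D x \<le> ?f x * g (?N x)" for x
    proof (cases "x \<in> ?D")
      case True
      have "?N x \<le> R\<^sup>2" using D(3)[OF True] R by (intro power_mono) auto
      moreover have "(norm x0 / 2)\<^sup>2 \<le> ?N x" using D(2)[OF True] by (intro power_mono) auto
      moreover from this have "2 * \<epsilon>\<^sup>2 \<le> ?N x" using sq by linarith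
      ultimately have "g (?N x) = 1"
        using \<epsilon>(1) \<open>0 < R\<close> by (simp add: g_def scaled_0_inner scaled_outer)
      then show ?thesis using D(1)[OF True] True by simp
    next
      case False
      have "0 \<le> ?f x * g (?N x)"
      proof (cases "x = 0")
        case True
        then show ?thesis 
          using scaled_diff_eq_0[OF \<epsilon>(1) \<open>0 < R\<close> \<epsilon>R, of 0 0] \<epsilon> by (simp add: g_def)
      next
        case False
        then show ?thesis
          using scaled_0_mono[OF \<epsilon>(1) \<open>0 < R\<close> \<epsilon>R] by (simp add: eq g_def)
      qed
      with False show ?thesis by simp
    qed
    then have "integral\<^sup>L lborel (\<lambda>x. k * indicator ?D x) \<le> integral\<^sup>L lborel (\<lambda>x. ?f x * g (?N x))"
      using int emeasure_lborel_cball_finite[of x0 \<rho>]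
      by (intro integral_mono)
        (auto simp: infinity_ennreal_def intro!: integrable_mult_right integrable_real_indicator)
    then show ?thesis by (simp add: L_def A_def g_def)
  qed
  define M where "M = 2 * (unit_ball_vol (real DIM('a)) * sqrt 2 ^ DIM('a))
      * (C * (2 * C * max 1 (sqrt 2 powr a)) powr (1 / (p - 1)))"
  \<comment> \<open>The exponent is negative because \<open>a\<close> is below the dimension.
    \<open>R\<close> is fixed first, making this term less than \<open>L / 2\<close>; then
    \<epsilon> is chosen so that \<open>2 * \<bar>J \<epsilon>\<bar>\<close> is also less than
    \<open>L / 2\<close>.\<close>
  have "((\<lambda>R. M * R powr ((a - DIM('a)) / (p - 1))) \<longlongrightarrow> M * 0) at_top"
    using a p by (intro tendsto_mult_left tendsto_neg_powr filterlim_ident) (auto simp: divide_neg_pos)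
  then have "\<forall>\<^sub>F R in at_top. M * R powr ((a - DIM('a)) / (p - 1)) < L / 2"
    using L by (intro order_tendstoD) auto
  then obtain R where R: "2 * norm x0 \<le> R" "M * R powr ((a - DIM('a)) / (p - 1)) < L / 2"
    using eventually_happens[OF eventually_conj[OF eventually_ge_at_top[of "2 * norm x0"]]] by force
  have "0 < R" using R x0 by (smt (verit) zero_less_norm_iff)
  have "((\<lambda>\<epsilon>. \<bar>J \<epsilon>\<bar>) \<longlongrightarrow> 0) (at_right 0)"
    unfolding J_def by (rule tendsto_rabs_zero[OF integral_scaled_tendsto_0[OF u_cont m]])
  then have "\<forall>\<^sub>F \<epsilon> in at_right 0. \<bar>J \<epsilon>\<bar> < L / 4"
    using L by (intro order_tendstoD) auto
  moreover have "\<forall>\<^sub>F \<epsilon> in at_right 0. \<epsilon> < norm x0 / 4" "\<forall>\<^sub>F \<epsilon>::real in at_right 0. 0 < \<epsilon>"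
    using x0 order_tendstoD(2)[OF tendsto_ident_at[of "0::real"], of "norm x0 / 4"]
    by (simp_all add: eventually_at_right_less)
  ultimately obtain \<epsilon> where \<epsilon>: "\<bar>J \<epsilon>\<bar> < L / 4" "\<epsilon> < norm x0 / 4" "0 < \<epsilon>"
    using eventually_happens[of "\<lambda>\<epsilon>. \<bar>J \<epsilon>\<bar> < L / 4 \<and> \<epsilon> < norm x0 / 4 \<and> 0 < \<epsilon>" "at_right (0::real)"]
    by (auto simp: eventually_conj_iff)
  have "2 * \<epsilon>\<^sup>2 \<le> R\<^sup>2"
  proof -
    have "(2 * \<epsilon>)\<^sup>2 \<le> R\<^sup>2" using \<epsilon> R by (intro power_mono) auto
    then have "4 * \<epsilon>\<^sup>2 \<le> R\<^sup>2" by (simp add: power_mult_distrib)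
    then show ?thesis using zero_le_power2[of \<epsilon>] by linarith
  qed
  then have "A R \<epsilon> \<le> M * R powr ((a - DIM('a)) / (p - 1)) + 2 * \<bar>J \<epsilon>\<bar>"
    unfolding A_def J_def M_def
    using \<epsilon> \<open>0 < R\<close> by (intro integral_neg_laplacian_power_le[OF u nonneg m p eq]) auto
  with lower[OF R(1) \<epsilon>(3)] \<epsilon> R(2) show False by simp
qed

end

theorem theorem1p1:
  fixes u :: "real ^ 'n \<Rightarrow> real" and a p :: real
  assumes "CARD('n) \<ge> 4" and "even CARD('n)"
    and "a < real CARD('n)" and "1 < p"
    and "hardy_henon_solution a p u"
    and "a \<le> 2 + 2 * p \<or> u \<in> o[at_infinity](\<lambda>x. norm x ^ 2)"
  shows "\<forall>x. u x = 0"
proof -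
  define m where "m = CARD('n) div 2"
  have m: "2 \<le> m" "DIM(real ^ 'n) = 2 * m" using assms(1,2) by (auto simp: m_def)
  have sol: "(if a \<le> 0 then C_k_on (2 * m) u UNIV else C_k_on (2 * m) u (- {0}) \<and> C_k_on (2 * m - 2) u UNIV)"
    "\<And>x. 0 \<le> u x"
    "\<And>x. x \<noteq> 0 \<Longrightarrow> neg_laplacian_power m u x = henon_weight a x * u x powr p"
    using assms(5) m unfolding hardy_henon_solution_def by auto
  have cont: "continuous_on UNIV u"
    using sol(1) C_k_on_mono[of _ u UNIV 0] by (auto split: if_splits)
  have C: "C_k_on (2 * m) u (- {0})"
    using sol(1) C_k_on_subset[of "2 * m" u UNIV "- {0}"] by (auto split: if_splits)
  \<comment> \<open>Off the origin \<open>norm x powr 0\<close> is 1, so the separate case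
    \<open>a = 0\<close> of the weight merges with the others.\<close>
  have eq: "neg_laplacian_power m u x = norm x powr (- a) * u x powr p" if "x \<noteq> 0" for x
    using sol(3)[OF that] that by (simp add: henon_weight_def)
  obtain h h1 h2 C where "radial_cutoff (real DIM(real ^ 'n)) p m h h1 h2 C"
    using radial_cutoff_exists[OF assms(4)] by blast
  then have zero: "u x = 0" if "x \<noteq> 0" for x
    using radial_cutoff.hardy_henon_eq_0[OF _ cont C sol(2) m refl assms(4) _ eq that] assms(3) by simp
  \<comment> \<open>The value at the origin follows by continuity, the punctured space being
    dense.\<close>
  have "continuous_on (closure (- {0})) u" using cont by (rule continuous_on_subset) simp
  then have "u x = 0" for x
    by (rule continuous_constant_on_closure[of "- {0}"]) (use zero in \<open>auto simp: closure_complement\<close>)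
  then show ?thesis by simp
qed

end
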